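(* Let $f\in\mathcal S_{\mu,L}$ on $\mathbb R^d$ with $L>\mu>0$, let $\kappa=L/\mu$, and let $x^\star$ be the minimizer of $f$. Set $$\alpha=\frac{1/\sqrt{\kappa}}{1-1/\sqrt{\kappa}}=\frac{1}{\sqrt{\kappa}-1},\qquad \beta>0 \text{ with } \alpha\beta=\frac1L .$$ Let $x_0,y_0\in\mathbb R^d$ be arbitrary and let $(x_k,y_k)_{k\ge 0}$ be generated by the HNAG$^+$ scheme $$\frac{x_{k+1}-x_k}{\alpha}=2(y_k-x_{k+1})-\beta\nabla f(x_k),\qquad \frac{y_{k+1}-y_k}{\alpha}=x_{k+1}-y_{k+1}-\frac1\mu\nabla f(x_{k+1}).$$ With $f_{-\mu}(x):=f(x)-\frac{\mu}{2}\|x-x^\star\|^2$ and $\mathcal E^+(x,y):=D_{f_{-\mu}}(x,x^\star)+\mu\|y-x^\star\|^2$, one has for all $k\ge 0$ $$\mathcal E^+(x_{k+1},y_{k+1})-\frac{1}{2(L-\mu)}\|\nabla f_{-\mu}(x_{k+1})\|^2\le \frac{\sqrt\kappa-1}{\sqrt\kappa+1}\left(\mathcal E^+(x_k,y_k)-\frac{1}{2(L-\mu)}\|\nabla f_{-\mu}(x_k)\|^2\right).$$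
   Context: $\mathcal S_{\mu,L}$ is the class of differentiable functions $f:\mathbb R^d\to\mathbb R$ that are $\mu$-strongly convex, i.e. $D_f(y,x)\ge\frac{\mu}{2}\|y-x\|^2$ for all $x,y$, and $L$-smooth, i.e. $\|\nabla f(y)-\nabla f(x)\|\le L\|y-x\|$ for all $x,y$. Such $f$ has a unique global minimizer $x^\star$. For a differentiable function $g$, the Bregman divergence is $D_g(y,x):=g(y)-g(x)-\langle\nabla g(x),y-x\rangle$. Norms and inner products are Euclidean. *)

theory Defs
  imports "HOL-Analysis.Analysis"
begin

(* The library has the gradient only as the relation GDERIV; this is the corresponding function,
   meaningful where f is differentiable (see GDERIV_gradient). *)
definition gradient :: "('a::real_inner \<Rightarrow> real) \<Rightarrow> 'a \<Rightarrow> 'a" where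
  "gradient f x = (THE D. GDERIV f x :> D)"

lemma gradient_eqI:
  assumes "GDERIV f x :> D"
  shows "gradient f x = D"
  unfolding gradient_def
proof (rule the_equality[where P = "\<lambda>D. GDERIV f x :> D", OF assms])
  fix E assume "GDERIV f x :> E"
  with assms have "(\<lambda>h. inner h E) = (\<lambda>h. inner h D)"
    unfolding gderiv_def by (rule has_derivative_unique[rotated])
  then have "inner (E - D) E = inner (E - D) D" by meson
  then have "inner (E - D) (E - D) = 0" by (simp add: inner_diff_right)
  then show "E = D" by simp
qed

lemma GDERIV_gradient:
  fixes f :: "'a::euclidean_space \<Rightarrow> real"
  assumes "f differentiable (at x)"
  shows "GDERIV f x :> gradient f x"
proof -
  obtain f' where f': "(f has_derivative f') (at x)"
    using assms unfolding differentiable_def by blast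
  interpret bounded_linear f' using f' by (rule has_derivative_bounded_linear)
  have "f' h = inner h (\<Sum>b\<in>Basis. f' b *\<^sub>R b)" for h
  proof -
    have "f' h = f' (\<Sum>b\<in>Basis. inner h b *\<^sub>R b)" by (simp add: euclidean_representation)
    also have "\<dots> = inner h (\<Sum>b\<in>Basis. f' b *\<^sub>R b)"
      by (simp add: sum scaleR inner_sum_right mult.commute)
    finally show ?thesis .
  qed
  then have "f' = (\<lambda>h. inner h (\<Sum>b\<in>Basis. f' b *\<^sub>R b))" by (rule ext)
  then have "GDERIV f x :> (\<Sum>b\<in>Basis. f' b *\<^sub>R b)"
    using f' unfolding gderiv_def by simp
  then show ?thesis using gradient_eqI by metis
qed

definition bregman :: "('a::real_inner \<Rightarrow> real) \<Rightarrow> 'a \<Rightarrow> 'a \<Rightarrow> real" where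
  "bregman g y x = g y - g x - inner (gradient g x) (y - x)"

definition smooth_strongly_convex :: "real \<Rightarrow> real \<Rightarrow> ('a::real_inner \<Rightarrow> real) set" where
  "smooth_strongly_convex \<mu> L = {f.
     (\<forall>x. f differentiable (at x)) \<and>
     (\<forall>x y. bregman f y x \<ge> \<mu> / 2 * (norm (y - x))\<^sup>2) \<and>
     (\<forall>x y. norm (gradient f y - gradient f x) \<le> L * norm (y - x))}"

definition shifted :: "('a::real_inner \<Rightarrow> real) \<Rightarrow> real \<Rightarrow> 'a \<Rightarrow> 'a \<Rightarrow> real" where
  "shifted f \<mu> xstar x = f x - \<mu> / 2 * (norm (x - xstar))\<^sup>2"

definition lyapunov_plus :: "('a::real_inner \<Rightarrow> real) \<Rightarrow> real \<Rightarrow> 'a \<Rightarrow> 'a \<Rightarrow> 'a \<Rightarrow> real" where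
  "lyapunov_plus f \<mu> xstar x y =
     bregman (shifted f \<mu> xstar) x xstar + \<mu> * (norm (y - xstar))\<^sup>2"

(* The scheme is implicit in the new iterate, so it is stated as a relation on sequences. *)
definition hnag_plus ::
    "('a::real_inner \<Rightarrow> real) \<Rightarrow> real \<Rightarrow> real \<Rightarrow> real \<Rightarrow> (nat \<Rightarrow> 'a) \<Rightarrow> (nat \<Rightarrow> 'a) \<Rightarrow> bool" where
  "hnag_plus f \<mu> \<alpha> \<beta> x y \<longleftrightarrow> (\<forall>k.
     (x (Suc k) - x k) /\<^sub>R \<alpha> = 2 *\<^sub>R (y k - x (Suc k)) - \<beta> *\<^sub>R gradient f (x k) \<and>
     (y (Suc k) - y k) /\<^sub>R \<alpha> = x (Suc k) - y (Suc k) - (1 / \<mu>) *\<^sub>R gradient f (x (Suc k)))"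

end

theory Submission
  imports Defs
begin

text \<open>
  Let \<open>h = f - \<mu>/2 \<parallel>\<cdot> - x\<^sup>\<star>\<parallel>\<^sup>2\<close> be the shifted function and \<open>M = L - \<mu>\<close>. Strong convexity and smoothness
  of \<open>f\<close> imply that the Bregman divergence of \<open>h\<close> lies between \<open>0\<close> and \<open>M/2 \<parallel>\<cdot>\<parallel>\<^sup>2\<close>, so \<open>h\<close> is
  cocoercive (lemma \<open>cocoercivity\<close>). Put
  \<open>p(x) = h(x) - h(x\<^sup>\<star>) - \<parallel>\<nabla>h(x)\<parallel>\<^sup>2/(2M)\<close> and \<open>u(x) = x - x\<^sup>\<star> - \<nabla>h(x)/M\<close>.
  Cocoercivity rearranges to \<open>p(b) \<ge> p(a) + \<langle>\<nabla>h(a), u(b) - u(a)\<rangle>\<close>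
  (lemma \<open>bregman_minus_gradient_norms_ge\<close>): seen as a function of \<open>u\<close>, the quantity \<open>p\<close> is convex
  with subgradient \<open>\<nabla>h\<close>, and its minimum is \<open>0\<close>, attained at \<open>x\<^sup>\<star>\<close>. The corrected Lyapunov function
  of the theorem is exactly \<open>p(x) + \<mu> \<parallel>y - x\<^sup>\<star>\<parallel>\<^sup>2\<close>.

  In these variables the scheme is simple. Write \<open>v = y - x\<^sup>\<star>\<close>, let primes denote the new iterate, and
  let \<open>g' = \<nabla>h(x')\<close>. Since \<open>1/L = (1 - 1/\<kappa>)/M\<close>, the explicit gradient step with \<open>\<alpha>\<beta> = 1/L\<close> combines
  with the contraction of \<open>x - x\<^sup>\<star>\<close> by \<open>1 - 1/\<kappa>\<close> into a multiple of \<open>u\<close>. The choice of \<open>\<alpha>\<close> amounts to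
  \<open>(1 + 2\<alpha>)/M = \<alpha>\<^sup>2/\<mu>\<close>, and yields

    \<open>v = (1 + \<alpha>) v' + (\<alpha>/\<mu>) g'\<close>,

    \<open>(1 + 2\<alpha>) u' = (1 - 1/\<kappa>) u + 2\<alpha>(1 + \<alpha>) v' + (\<alpha>\<^sup>2/\<mu>) g'\<close>.

  The last two terms of the second equation, paired with \<open>g'\<close>, are also the terms involving \<open>g'\<close> in
  the expansion of \<open>\<mu> \<parallel>v\<parallel>\<^sup>2\<close>. Hence the change of the kinetic part \<open>\<mu> \<parallel>v\<parallel>\<^sup>2\<close> controls
  \<open>\<langle>g', (1 + 2\<alpha>) u' - (1 - 1/\<kappa>) u\<rangle>\<close>, which by two subgradient inequalities at \<open>x'\<close> controls the
  change of \<open>p\<close>. Lemma \<open>one_step_contraction\<close> carries this out; it gives the factor \<open>1/(1 + 2\<alpha>)\<close>,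
  which equals \<open>(\<surd>\<kappa> - 1)/(\<surd>\<kappa> + 1)\<close>.
\<close>

section \<open>Smooth functions and cocoercivity\<close>

lemma smooth_strongly_convexD:
  fixes f :: "'a::euclidean_space \<Rightarrow> real"
  assumes "f \<in> smooth_strongly_convex \<mu> L"
  shows "GDERIV f x :> gradient f x"
    and "\<mu> / 2 * (norm (y - x))\<^sup>2 \<le> bregman f y x"
    and "norm (gradient f y - gradient f x) \<le> L * norm (y - x)"
  using assms unfolding smooth_strongly_convex_def by (auto intro: GDERIV_gradient)

text \<open>
  The descent lemma. Along the segment from \<open>x\<close> to \<open>y\<close>, the difference \<open>\<psi>\<close> of the two sides, up to a constant, has a
  nonpositive derivative by Cauchy-Schwarz, so it does not increase.
\<close>

lemma bregman_le_of_lipschitz_gradient: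
  fixes f :: "'a::real_inner \<Rightarrow> real"
  assumes D: "\<And>x. GDERIV f x :> gradient f x"
    and lip: "\<And>x y. norm (gradient f y - gradient f x) \<le> L * norm (y - x)"
  shows "bregman f y x \<le> L / 2 * (norm (y - x))\<^sup>2"
proof -
  define v where "v = y - x"
  define \<psi> where "\<psi> t = f (x + t *\<^sub>R v) - t * inner (gradient f x) v - L / 2 * t\<^sup>2 * (norm v)\<^sup>2" for t
  define \<psi>' where "\<psi>' t = inner (gradient f (x + t *\<^sub>R v) - gradient f x) v - L * t * (norm v)\<^sup>2" for t
  have der: "(\<psi> has_real_derivative \<psi>' t) (at t)" for t
  proof -
    have f: "(f has_derivative (\<lambda>h. inner h (gradient f (x + t *\<^sub>R v)))) (at (x + t *\<^sub>R v))"
      using D[of "x + t *\<^sub>R v"] by (simp add: gderiv_def)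
    have "((\<lambda>t. x + t *\<^sub>R v) has_derivative (\<lambda>h. h *\<^sub>R v)) (at t)"
      by (auto intro!: derivative_eq_intros)
    from diff_chain_at[OF this f]
    have "((\<lambda>t. f (x + t *\<^sub>R v)) has_derivative (\<lambda>h. inner (h *\<^sub>R v) (gradient f (x + t *\<^sub>R v)))) (at t)"
      by (simp add: o_def)
    then have "((\<lambda>t. f (x + t *\<^sub>R v)) has_real_derivative inner (gradient f (x + t *\<^sub>R v)) v) (at t)"
      by (simp add: has_field_derivative_def mult.commute inner_commute mult_commute_abs)
    then show ?thesis
      unfolding \<psi>_def[abs_def] \<psi>'_def
      by (auto intro!: derivative_eq_intros simp: inner_diff_left)
  qed
  have "\<psi>' t \<le> 0" if "0 \<le> t" for t
  proof -
    have "inner (gradient f (x + t *\<^sub>R v) - gradient f x) v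
        \<le> norm (gradient f (x + t *\<^sub>R v) - gradient f x) * norm v"
      by (rule norm_cauchy_schwarz)
    also have "\<dots> \<le> L * norm (t *\<^sub>R v) * norm v"
      using lip[of "x + t *\<^sub>R v" x] by (intro mult_right_mono) auto
    finally show ?thesis
      using that by (simp add: \<psi>'_def power2_eq_square mult.assoc)
  qed
  then have "\<psi> 1 \<le> \<psi> 0"
    using der by (intro DERIV_nonpos_imp_nonincreasing[of 0 1 \<psi>]) (simp, blast)
  then show ?thesis
    by (simp add: \<psi>_def v_def bregman_def)
qed

text \<open>
  The point \<open>z\<close> below minimizes the quadratic upper model of \<open>h\<close> at \<open>y\<close> after the linear
  part of \<open>h\<close> at \<open>x\<close> is subtracted; convexity says that even there the value is nonnegative.
\<close>

lemma cocoercivity: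
  fixes h :: "'a::real_inner \<Rightarrow> real"
  assumes "0 < M"
    and lower: "\<And>x y. 0 \<le> bregman h y x"
    and upper: "\<And>x y. bregman h y x \<le> M / 2 * (norm (y - x))\<^sup>2"
  shows "1 / (2 * M) * (norm (gradient h y - gradient h x))\<^sup>2 \<le> bregman h y x"
proof -
  define d where "d = gradient h y - gradient h x"
  define z where "z = y - (1 / M) *\<^sub>R d"
  have "0 \<le> bregman h z x" by (rule lower)
  also have "\<dots> = bregman h z y + bregman h y x + inner d (z - y)"
    by (simp add: bregman_def d_def algebra_simps inner_diff_left inner_diff_right)
  also have "\<dots> \<le> M / 2 * (norm (z - y))\<^sup>2 + bregman h y x + inner d (z - y)"
    using upper[of z y] by simp
  also have "z - y = - (1 / M) *\<^sub>R d" by (simp add: z_def)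
  also have "M / 2 * (norm (- (1 / M) *\<^sub>R d))\<^sup>2 + bregman h y x + inner d (- (1 / M) *\<^sub>R d)
      = bregman h y x - 1 / (2 * M) * (norm d)\<^sup>2"
    using \<open>0 < M\<close> by (simp add: dot_square_norm power_mult_distrib field_simps power2_eq_square)
  finally show ?thesis by (simp add: d_def)
qed

text \<open>
  Cocoercivity in the form of a subgradient inequality: \<open>h - \<parallel>\<nabla>h\<parallel>\<^sup>2/(2M)\<close>, as a function of
  \<open>x - \<nabla>h(x)/M\<close>, has subgradient \<open>\<nabla>h(x)\<close>. Expanding the square
  \<open>\<parallel>\<nabla>h(y) - \<nabla>h(x)\<parallel>\<^sup>2\<close> moves the cross term into the shift of the points.
\<close>

lemma bregman_minus_gradient_norms_ge:
  fixes h :: "'a::real_inner \<Rightarrow> real"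
  assumes "1 / (2 * M) * (norm (gradient h y - gradient h x))\<^sup>2 \<le> bregman h y x"
  shows "h x - 1 / (2 * M) * (norm (gradient h x))\<^sup>2
      + inner (gradient h x) ((y - (1 / M) *\<^sub>R gradient h y) - (x - (1 / M) *\<^sub>R gradient h x))
    \<le> h y - 1 / (2 * M) * (norm (gradient h y))\<^sup>2"
proof -
  define r where "r = 1 / (2 * M)"
  have r: "1 / M = 2 * r" by (simp add: r_def)
  let ?a = "gradient h x" and ?b = "gradient h y"
  have "r * (norm (?b - ?a))\<^sup>2 = r * (norm ?b)\<^sup>2 - 2 * (r * inner ?a ?b) + r * (norm ?a)\<^sup>2"
    by (simp add: power2_norm_eq_inner inner_diff_left inner_diff_right inner_commute algebra_simps)
  moreover have "inner ?a ((y - (2 * r) *\<^sub>R ?b) - (x - (2 * r) *\<^sub>R ?a))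
      = inner ?a (y - x) - 2 * (r * inner ?a ?b) + 2 * (r * (norm ?a)\<^sup>2)"
    by (simp add: power2_norm_eq_inner inner_diff_right)
  ultimately show ?thesis
    using assms unfolding r r_def[symmetric] bregman_def by linarith
qed

section \<open>The shifted function and the minimizer\<close>

lemma gradient_shifted:
  assumes "GDERIV f x :> gradient f x"
  shows "gradient (shifted f \<mu> c) x = gradient f x - \<mu> *\<^sub>R (x - c)"
proof (rule gradient_eqI)
  have "((\<lambda>x. f x - \<mu> / 2 * inner (x - c) (x - c)) has_derivative
      (\<lambda>h. inner h (gradient f x) - \<mu> / 2 * (inner (x - c) h + inner h (x - c)))) (at x)"
    using assms unfolding gderiv_def by (auto intro!: derivative_eq_intros)
  also have "(\<lambda>h. inner h (gradient f x) - \<mu> / 2 * (inner (x - c) h + inner h (x - c)))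
      = (\<lambda>h. inner h (gradient f x - \<mu> *\<^sub>R (x - c)))"
    by (rule ext) (simp add: inner_diff_left inner_diff_right inner_add_right inner_commute field_simps)
  finally show "GDERIV (shifted f \<mu> c) x :> gradient f x - \<mu> *\<^sub>R (x - c)"
    unfolding gderiv_def shifted_def[abs_def] power2_norm_eq_inner .
qed

lemma bregman_shifted:
  assumes "GDERIV f x :> gradient f x"
  shows "bregman (shifted f \<mu> c) y x = bregman f y x - \<mu> / 2 * (norm (y - x))\<^sup>2"
  unfolding bregman_def gradient_shifted[OF assms] shifted_def power2_norm_eq_inner
  by (simp add: inner_diff_left inner_diff_right inner_add_left inner_add_right inner_commute field_simps)

text \<open>
  A gradient step of length \<open>1/L\<close> lowers the value by at least \<open>\<parallel>\<nabla>f\<parallel>\<^sup>2/(2L)\<close>, which is impossible at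
  a minimizer unless the gradient vanishes.
\<close>

lemma gradient_at_minimizer:
  fixes f :: "'a::real_inner \<Rightarrow> real"
  assumes "0 < L"
    and upper: "\<And>x y. bregman f y x \<le> L / 2 * (norm (y - x))\<^sup>2"
    and min: "is_arg_min f (\<lambda>_. True) c"
  shows "gradient f c = 0"
proof -
  let ?g = "gradient f c"
  have "f c \<le> f (c - (1 / L) *\<^sub>R ?g)"
    using min by (simp add: is_arg_min_linorder)
  moreover have "f (c - (1 / L) *\<^sub>R ?g) - f c
      \<le> L / 2 * (norm (- (1 / L) *\<^sub>R ?g))\<^sup>2 + inner ?g (- (1 / L) *\<^sub>R ?g)"
    using upper[of "c - (1 / L) *\<^sub>R ?g" c] by (simp add: bregman_def)
  moreover have "L / 2 * (norm (- (1 / L) *\<^sub>R ?g))\<^sup>2 + inner ?g (- (1 / L) *\<^sub>R ?g)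
      = - ((norm ?g)\<^sup>2 / (2 * L))"
    using \<open>0 < L\<close> by (simp add: dot_square_norm power_mult_distrib field_simps power2_eq_square)
  ultimately have "(norm ?g)\<^sup>2 / (2 * L) \<le> 0" by linarith
  then show ?thesis using \<open>0 < L\<close> by (simp add: divide_le_0_iff)
qed

section \<open>Contraction in one step\<close>

text \<open>
  One step of the scheme, abstracted to vectors and numbers: \<open>\<phi>\<close> and \<open>\<phi>'\<close> are the values at \<open>u\<close> and \<open>u'\<close>
  of a convex function with minimum \<open>0\<close> at the origin, and \<open>g\<close> is a subgradient at the new point \<open>u'\<close>.
  The inequality is \<open>c\<close> times the subgradient inequality towards \<open>u\<close> plus \<open>1 + 2\<alpha> - c\<close> times the one
  towards the origin. Only \<open>c \<phi>\<close> of the available \<open>\<phi>\<close> is consumed, and \<open>\<phi> \<ge> 0\<close> absorbs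
  the rest; the weight \<open>c\<close> is forced by the coefficient of \<open>u\<close> in the recursion for \<open>u'\<close>.
\<close>

lemma one_step_contraction:
  fixes u u' v v' g :: "'a::real_inner" and \<phi> \<phi>' \<mu> \<alpha> c :: real
  assumes "0 < \<mu>" and "0 \<le> \<alpha>" and "0 \<le> c" and "c \<le> 1"
    and v: "v = (1 + \<alpha>) *\<^sub>R v' + (\<alpha> / \<mu>) *\<^sub>R g"
    and u: "(1 + 2 * \<alpha>) *\<^sub>R u' = c *\<^sub>R u + (2 * \<alpha> * (1 + \<alpha>)) *\<^sub>R v' + (\<alpha>\<^sup>2 / \<mu>) *\<^sub>R g"
    and "0 \<le> \<phi>"
    and sub: "\<phi>' + inner g (u - u') \<le> \<phi>"
    and sub0: "\<phi>' \<le> inner g u'"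
  shows "(1 + 2 * \<alpha>) * (\<phi>' + \<mu> * (norm v')\<^sup>2) \<le> \<phi> + \<mu> * (norm v)\<^sup>2"
proof -
  \<comment> \<open>The recursion for \<open>u'\<close> turns the terms with \<open>g\<close> in \<open>\<mu> \<parallel>v\<parallel>\<^sup>2\<close> into pairings with \<open>u\<close> and \<open>u'\<close>.\<close>
  have "(1 + 2 * \<alpha>) * inner g u' = inner g ((1 + 2 * \<alpha>) *\<^sub>R u')" by simp
  also have "\<dots> = c * inner g u + 2 * \<alpha> * (1 + \<alpha>) * inner g v' + \<alpha>\<^sup>2 / \<mu> * inner g g"
    unfolding u by (simp add: inner_add_right)
  finally have cross: "2 * \<alpha> * (1 + \<alpha>) * inner g v' + \<alpha>\<^sup>2 / \<mu> * inner g g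
      = (1 + 2 * \<alpha>) * inner g u' - c * inner g u" by simp
  have "\<mu> * (norm v)\<^sup>2 = (1 + 2 * \<alpha>) * (\<mu> * (norm v')\<^sup>2) + \<mu> * \<alpha>\<^sup>2 * (norm v')\<^sup>2
      + (2 * \<alpha> * (1 + \<alpha>) * inner g v' + \<alpha>\<^sup>2 / \<mu> * inner g g)"
    unfolding v power2_norm_eq_inner using \<open>0 < \<mu>\<close>
    by (simp add: inner_add_left inner_add_right inner_commute field_simps power2_eq_square)
  \<comment> \<open>The only loss here is the term \<open>\<mu> \<alpha>\<^sup>2 \<parallel>v'\<parallel>\<^sup>2\<close>.\<close>
  also have "\<dots> \<ge> (1 + 2 * \<alpha>) * (\<mu> * (norm v')\<^sup>2) + ((1 + 2 * \<alpha>) * inner g u' - c * inner g u)"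
    using \<open>0 < \<mu>\<close> unfolding cross by simp
  finally have kinetic: "(1 + 2 * \<alpha>) * (\<mu> * (norm v')\<^sup>2)
      + ((1 + 2 * \<alpha>) * inner g u' - c * inner g u) \<le> \<mu> * (norm v)\<^sup>2" .
  have "(1 + 2 * \<alpha>) * \<phi>' = c * \<phi>' + (1 + 2 * \<alpha> - c) * \<phi>'"
    by (simp add: algebra_simps)
  also have "\<dots> \<le> c * (\<phi> - inner g (u - u')) + (1 + 2 * \<alpha> - c) * inner g u'"
    using assms by (intro add_mono mult_left_mono) auto
  also have "\<dots> = c * \<phi> + ((1 + 2 * \<alpha>) * inner g u' - c * inner g u)"
    by (simp add: inner_diff_right algebra_simps)
  also have "\<dots> \<le> \<phi> + ((1 + 2 * \<alpha>) * inner g u' - c * inner g u)"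
    using \<open>0 \<le> \<phi>\<close> \<open>c \<le> 1\<close> by (simp add: mult_left_le_one_le \<open>0 \<le> c\<close>)
  finally show ?thesis using kinetic by (simp add: distrib_left)
qed

theorem theorem4p1:
  fixes f :: "real ^ 'd \<Rightarrow> real"
    and \<mu> L \<kappa> \<alpha> \<beta> :: real
    and xstar :: "real ^ 'd"
    and x y :: "nat \<Rightarrow> real ^ 'd"
    and k :: nat
  assumes "0 < \<mu>" and "\<mu> < L"
    and "f \<in> smooth_strongly_convex \<mu> L"
    and "\<kappa> = L / \<mu>"
    and "is_arg_min f (\<lambda>_. True) xstar"
    and "\<alpha> = (1 / sqrt \<kappa>) / (1 - 1 / sqrt \<kappa>)"
    and "\<beta> > 0" and "\<alpha> * \<beta> = 1 / L"
    and "hnag_plus f \<mu> \<alpha> \<beta> x y"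
  shows "lyapunov_plus f \<mu> xstar (x (Suc k)) (y (Suc k))
           - 1 / (2 * (L - \<mu>)) * (norm (gradient (shifted f \<mu> xstar) (x (Suc k))))\<^sup>2
         \<le> (sqrt \<kappa> - 1) / (sqrt \<kappa> + 1) *
           (lyapunov_plus f \<mu> xstar (x k) (y k)
              - 1 / (2 * (L - \<mu>)) * (norm (gradient (shifted f \<mu> xstar) (x k)))\<^sup>2)"
proof -
  note f = smooth_strongly_convexD[OF assms(3)]
  define M where "M = L - \<mu>"
  define h where "h = shifted f \<mu> xstar"
  define s where "s = sqrt \<kappa>"
  have "0 < M" "0 < L" using assms by (auto simp: M_def)
  have f_upper: "bregman f b a \<le> L / 2 * (norm (b - a))\<^sup>2" for a b
    by (rule bregman_le_of_lipschitz_gradient) (rule f)+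
  have h_lower: "0 \<le> bregman h b a" for a b
    using f(2)[of b a] by (simp add: h_def bregman_shifted[OF f(1)])
  have h_upper: "bregman h b a \<le> M / 2 * (norm (b - a))\<^sup>2" for a b
    using f_upper[of b a] by (simp add: h_def M_def bregman_shifted[OF f(1)] field_simps)
  have grad_h: "gradient h a = gradient f a - \<mu> *\<^sub>R (a - xstar)" for a
    unfolding h_def by (rule gradient_shifted[OF f(1)])
  have grad_h_xstar: "gradient h xstar = 0"
    using gradient_at_minimizer[OF \<open>0 < L\<close> f_upper assms(5)] by (simp add: grad_h)

  \<comment> \<open>In the coordinate \<open>u\<close> the potential \<open>p\<close> is convex, with minimum \<open>0\<close> at the origin.\<close>
  define p where "p a = h a - h xstar - 1 / (2 * M) * (norm (gradient h a))\<^sup>2" for a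
  define u where "u a = a - xstar - (1 / M) *\<^sub>R gradient h a" for a
  have sub: "p a + inner (gradient h a) (u b - u a) \<le> p b" for a b
  proof -
    have "u b - u a = (b - (1 / M) *\<^sub>R gradient h b) - (a - (1 / M) *\<^sub>R gradient h a)"
      by (simp add: u_def)
    then show ?thesis
      using bregman_minus_gradient_norms_ge[OF cocoercivity[OF \<open>0 < M\<close> h_lower h_upper], of a b]
      unfolding p_def by simp
  qed
  have origin: "p xstar = 0" "u xstar = 0"
    by (simp_all add: p_def u_def grad_h_xstar)
  have energy: "lyapunov_plus f \<mu> xstar a b - 1 / (2 * (L - \<mu>)) * (norm (gradient h a))\<^sup>2
      = p a + \<mu> * (norm (b - xstar))\<^sup>2" for a b
    by (simp add: lyapunov_plus_def bregman_def grad_h_xstar p_def M_def flip: h_def)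

  have "1 < s" using assms by (simp add: s_def)
  have \<alpha>: "\<alpha> = 1 / (s - 1)"
    using \<open>1 < s\<close> assms(6) by (simp add: s_def[symmetric] field_simps)
  have "s\<^sup>2 = \<kappa>" using assms by (simp add: s_def)
  then have L: "L = \<mu> * s\<^sup>2" using assms by simp
  have "0 < \<alpha>" using \<open>1 < s\<close> by (simp add: \<alpha>)
  have rate: "(s - 1) / (s + 1) = 1 / (1 + 2 * \<alpha>)"
    using \<open>1 < s\<close> by (simp add: \<alpha> field_simps)
  \<comment> \<open>This identity fixes the size of \<open>\<alpha>\<close>: replacing \<open>x'\<close> by \<open>u'\<close> in the scheme costs
      \<open>(1 + 2\<alpha>)/M\<close> times the new gradient, which is half of what \<open>2\<alpha> v\<close> contributes.\<close>
  have critical: "(1 + 2 * \<alpha>) / M = \<alpha>\<^sup>2 / \<mu>"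
  proof -
    have M: "M = \<mu> * ((s - 1) * (s + 1))"
      by (simp add: M_def L algebra_simps power2_eq_square)
    have "1 + 2 * \<alpha> = (s + 1) / (s - 1)" using \<open>1 < s\<close> by (simp add: \<alpha> field_simps)
    then show ?thesis
      using \<open>1 < s\<close> assms(1) by (simp add: M \<alpha> power2_eq_square)
  qed

  \<comment> \<open>The scheme in the variables \<open>u\<close> and \<open>v\<close>. In the equation for \<open>y\<close> the strongly convex part of the
      gradient of \<open>f\<close> cancels the position of the new iterate relative to the minimizer.\<close>
  define x0 x1 where "x0 = x k" and "x1 = x (Suc k)"
  define v0 v1 where "v0 = y k - xstar" and "v1 = y (Suc k) - xstar"
  define g1 where "g1 = gradient h x1"
  have scheme: "(x1 - x0) /\<^sub>R \<alpha> = 2 *\<^sub>R (y k - x1) - \<beta> *\<^sub>R gradient f x0"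
      "(y (Suc k) - y k) /\<^sub>R \<alpha> = x1 - y (Suc k) - (1 / \<mu>) *\<^sub>R gradient f x1"
    using assms(9) by (simp_all add: hnag_plus_def x0_def x1_def)
  have "y (Suc k) - y k = \<alpha> *\<^sub>R ((y (Suc k) - y k) /\<^sub>R \<alpha>)" using \<open>0 < \<alpha>\<close> by simp
  also have "\<dots> = \<alpha> *\<^sub>R (- v1 - (1 / \<mu>) *\<^sub>R g1)"
    unfolding scheme g1_def grad_h v1_def using assms(1) by (simp add: algebra_simps)
  finally have v: "v0 = (1 + \<alpha>) *\<^sub>R v1 + (\<alpha> / \<mu>) *\<^sub>R g1"
    by (simp add: v0_def v1_def algebra_simps)
  have "x1 - x0 = \<alpha> *\<^sub>R ((x1 - x0) /\<^sub>R \<alpha>)" using \<open>0 < \<alpha>\<close> by simp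
  also have "\<dots> = (2 * \<alpha>) *\<^sub>R (y k - x1) - (\<alpha> * \<beta>) *\<^sub>R gradient f x0"
    unfolding scheme by (simp add: algebra_simps)
  also have "\<dots> = (2 * \<alpha>) *\<^sub>R (v0 - (x1 - xstar))
      - (1 / L) *\<^sub>R (gradient h x0 + \<mu> *\<^sub>R (x0 - xstar))"
    unfolding assms(8) by (simp add: grad_h v0_def)
  finally have "(1 + 2 * \<alpha>) *\<^sub>R (x1 - xstar)
      = (1 - \<mu> / L) *\<^sub>R (x0 - xstar) - (1 / L) *\<^sub>R gradient h x0 + (2 * \<alpha>) *\<^sub>R v0"
    by (simp add: algebra_simps)
  \<comment> \<open>The step size \<open>1/L\<close> for \<open>f\<close> is the step size \<open>1/M\<close> for \<open>h\<close> after the contraction by \<open>1 - \<mu>/L\<close>,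
      so the first two terms form a multiple of \<open>u x0\<close>.\<close>
  also have "1 / L = (1 - \<mu> / L) / M"
    using \<open>0 < M\<close> \<open>0 < L\<close> by (simp add: M_def field_simps)
  finally have "(1 + 2 * \<alpha>) *\<^sub>R (x1 - xstar) = (1 - \<mu> / L) *\<^sub>R u x0 + (2 * \<alpha>) *\<^sub>R v0"
    by (simp add: u_def scaleR_diff_right)
  then have u1: "(1 + 2 * \<alpha>) *\<^sub>R u x1
      = (1 - \<mu> / L) *\<^sub>R u x0 + (2 * \<alpha>) *\<^sub>R v0 - ((1 + 2 * \<alpha>) / M) *\<^sub>R g1"
    by (simp add: u_def g1_def scaleR_diff_right)
  have "(2 * \<alpha>) *\<^sub>R v0
      = (2 * \<alpha> * (1 + \<alpha>)) *\<^sub>R v1 + ((\<alpha>\<^sup>2 / \<mu>) *\<^sub>R g1 + (\<alpha>\<^sup>2 / \<mu>) *\<^sub>R g1)"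
    unfolding v scaleR_add_left[symmetric] by (simp add: scaleR_add_right power2_eq_square)
  with u1 have u: "(1 + 2 * \<alpha>) *\<^sub>R u x1
      = (1 - \<mu> / L) *\<^sub>R u x0 + (2 * \<alpha> * (1 + \<alpha>)) *\<^sub>R v1 + (\<alpha>\<^sup>2 / \<mu>) *\<^sub>R g1"
    unfolding critical by simp

  have "(1 + 2 * \<alpha>) * (p x1 + \<mu> * (norm v1)\<^sup>2) \<le> p x0 + \<mu> * (norm v0)\<^sup>2"
  proof (rule one_step_contraction[OF _ _ _ _ v u])
    show "0 \<le> p x0" using sub[of xstar x0] by (simp add: origin grad_h_xstar)
    show "p x1 + inner g1 (u x0 - u x1) \<le> p x0" using sub by (simp add: g1_def)
    show "p x1 \<le> inner g1 (u x1)" using sub[of x1 xstar] by (simp add: origin g1_def)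
  qed (use assms(1,2) \<open>0 < \<alpha>\<close> in auto)
  then have "p x1 + \<mu> * (norm v1)\<^sup>2 \<le> (s - 1) / (s + 1) * (p x0 + \<mu> * (norm v0)\<^sup>2)"
    unfolding rate using \<open>0 < \<alpha>\<close> by (simp add: pos_le_divide_eq mult.commute)
  then show ?thesis
    by (simp only: energy x0_def x1_def v0_def v1_def flip: h_def s_def)
qed

end
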